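(* Let $n\geq1$ and, for $i=1,\dots,n$, let $a_{i1},a_{i2},b_{i1},b_{i2},\alpha_i,\beta_i\in\mathbb{C}$, $\lambda_i\in\mathbb{C}\setminus\{0\}$. On $\mathbb{R}^4$ put $$L_i=\tfrac{1}{\sqrt2}\big[(\lambda_i\alpha_i+\beta_i)x^1+(\lambda_i\beta_i-\alpha_i)x^2+(\lambda_i\alpha_i-\beta_i)x^3+(\lambda_i\beta_i+\alpha_i)x^4\big],$$ $$A_i=a_{i1}e^{L_i}+a_{i2}e^{-L_i},\quad B_i=b_{i1}e^{L_i}+b_{i2}e^{-L_i},\quad\psi_i=\begin{pmatrix}A_i&\overline B_i\\-B_i&\overline A_i\end{pmatrix},\quad\Lambda_i=\begin{pmatrix}\lambda_i&0\\0&\overline\lambda_i\end{pmatrix},$$ and let $J_{n+1}$ be the quasi-Wronskian built from $(\psi_i,\Lambda_i)_{i=1}^n$. Then the gauge fields $$A^{(n+1)}_1=A^{(n+1)}_3=-\tfrac12\big[(\partial_1J_{n+1})J_{n+1}^{-1}+(\partial_3J_{n+1})J_{n+1}^{-1}\big],$$ $$A^{(n+1)}_2=A^{(n+1)}_4=-\tfrac12\big[(\partial_2J_{n+1})J_{n+1}^{-1}+(\partial_4J_{n+1})J_{n+1}^{-1}\big]$$ on the Ultrahyperbolic space are all anti-Hermitian and traceless (wherever $J_{n+1}$ is defined), i.e. take values in $\mathfrak{su}(2)$; therefore the gauge group can be $\mathrm{SU}(2)$.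
   Context: The Ultrahyperbolic space is $\mathbb{R}^4$ with the metric of signature $(+,+,-,-)$; $\partial_\mu=\partial/\partial x^\mu$. The quasi-Wronskian is the $2\times2$ matrix function given by the quasideterminant $$J_{n+1}=\begin{vmatrix}\psi_1&\cdots&\psi_n&1\\\psi_1\Lambda_1&\cdots&\psi_n\Lambda_n&0\\\vdots&&\vdots&\vdots\\\psi_1\Lambda_1^{n}&\cdots&\psi_n\Lambda_n^{n}&\boxed{0}\end{vmatrix}=-\big(\psi_1\Lambda_1^n,\dots,\psi_n\Lambda_n^n\big)\,W^{-1}\,(1,0,\dots,0)^T,$$ where $W$ is the $n\times n$ block matrix (with $2\times2$ blocks) whose $(r,s)$ block is $\psi_s\Lambda_s^{r-1}$, $1$ and $0$ denote the $2\times 2$ identity and zero matrices, and $J_{n+1}$ is defined at points of the open set where $W$ is invertible. *)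

theory Defs
  imports "HOL-Analysis.Analysis" "Jordan_Normal_Form.Schur_Decomposition"
begin

no_notation vec_index (infixl "$" 100)

text \<open>Matrices are those of \<^theory>\<open>Jordan_Normal_Form.Matrix\<close>, since the size $2n$ is a term;
  points of $R^4$ have type \<^typ>\<open>real^4\<close>, with coordinates $x^1,\dots,x^4$ given by
  \<open>x $ 1, \<dots>, x $ 4\<close>. In the index type the numeral 4 denotes the element 0, so 1, 2, 3, 4
  are its four distinct elements.\<close>

definition mat_inv :: "complex mat \<Rightarrow> complex mat" where
  "mat_inv A = the (mat_inverse A)"

definition mat_trace :: "complex mat \<Rightarrow> complex" where
  "mat_trace A = (\<Sum>i<dim_row A. A $$ (i, i))"

definition mat2 :: "complex \<Rightarrow> complex \<Rightarrow> complex \<Rightarrow> complex \<Rightarrow> complex mat" where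
  "mat2 a b c d = mat_of_rows_list 2 [[a, b], [c, d]]"


subsection \<open>The quasi-Wronskian\<close>

text \<open>The block matrix with $m \times m$ blocks of size $2 \times 2$; the block position \<open>(r, s)\<close>
  is counted from 1, the scalar entries from 0.\<close>

definition block_mat2 :: "nat \<Rightarrow> (nat \<Rightarrow> nat \<Rightarrow> complex mat) \<Rightarrow> complex mat" where
  "block_mat2 m B =
     mat (2 * m) (2 * m) (\<lambda>(i, j). B (i div 2 + 1) (j div 2 + 1) $$ (i mod 2, j mod 2))"

text \<open>The quasideterminant of a square matrix with the bottom right $2 \times 2$ block boxed.\<close>

definition quasidet_last :: "complex mat \<Rightarrow> complex mat" where
  "quasidet_last M =
     (case split_block M (dim_row M - 2) (dim_col M - 2) of
        (W, c, r, d) \<Rightarrow> d - r * mat_inv W * c)"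

definition wronski_mat ::
  "nat \<Rightarrow> (nat \<Rightarrow> real^4 \<Rightarrow> complex mat) \<Rightarrow> (nat \<Rightarrow> complex mat) \<Rightarrow> real^4 \<Rightarrow> complex mat" where
  "wronski_mat n \<psi> \<Lambda> x = block_mat2 n (\<lambda>r s. \<psi> s x * \<Lambda> s ^\<^sub>m (r - 1))"

definition quasi_wronskian ::
  "nat \<Rightarrow> (nat \<Rightarrow> real^4 \<Rightarrow> complex mat) \<Rightarrow> (nat \<Rightarrow> complex mat) \<Rightarrow> real^4 \<Rightarrow> complex mat" where
  "quasi_wronskian n \<psi> \<Lambda> x = quasidet_last (block_mat2 (n + 1) (\<lambda>r s.
     if s \<le> n then \<psi> s x * \<Lambda> s ^\<^sub>m (r - 1) else if r = 1 then 1\<^sub>m 2 else 0\<^sub>m 2 2))"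

lemma quasi_wronskian_eq:
  assumes "n \<ge> 1"
    and inv: "invertible_mat (wronski_mat n \<psi> \<Lambda> x)"
  shows "quasi_wronskian n \<psi> \<Lambda> x =
    - (mat 2 (2 * n) (\<lambda>(i, j). (\<psi> (j div 2 + 1) x * \<Lambda> (j div 2 + 1) ^\<^sub>m n) $$ (i, j mod 2))
       * mat_inv (wronski_mat n \<psi> \<Lambda> x)
       * mat (2 * n) 2 (\<lambda>(i, j). if i = j then 1 else 0))"
proof -
  let ?M = "block_mat2 (n + 1) (\<lambda>r s.
     if s \<le> n then \<psi> s x * \<Lambda> s ^\<^sub>m (r - 1) else if r = 1 then 1\<^sub>m 2 else 0\<^sub>m 2 2)"
  let ?W = "wronski_mat n \<psi> \<Lambda> x"
  let ?r = "mat 2 (2 * n) (\<lambda>(i, j). (\<psi> (j div 2 + 1) x * \<Lambda> (j div 2 + 1) ^\<^sub>m n) $$ (i, j mod 2))"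
  let ?c = "mat (2 * n) 2 (\<lambda>(i, j). if i = j then 1 else (0::complex))"
  have small: "j div 2 < n" if "j < 2 * n" for j using that by linarith
  have dim: "dim_row ?M - 2 = 2 * n" "dim_col ?M - 2 = 2 * n"
    by (simp_all add: block_mat2_def)
  have W: "mat (2 * n) (2 * n) (\<lambda>ij. ?M $$ ij) = ?W"
    by (rule eq_matI) (auto simp: wronski_mat_def block_mat2_def dest: small)
  have c: "mat (2 * n) 2 (\<lambda>(i, j). ?M $$ (i, j + 2 * n)) = ?c"
  proof (rule eq_matI)
    fix i j assume ij: "i < dim_row ?c" "j < dim_col ?c"
    hence j: "j = 0 \<or> j = 1" and i: "i < 2 * n" by auto
    have d: "(j + 2 * n) div 2 = n" "(j + 2 * n) mod 2 = j" using j by auto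
    have i2: "i = i mod 2 \<longleftrightarrow> i div 2 = 0" by presburger
    show "mat (2 * n) 2 (\<lambda>(i, j). ?M $$ (i, j + 2 * n)) $$ (i, j) = ?c $$ (i, j)"
      using i j d i2 by (cases "i div 2 = 0") (auto simp: block_mat2_def)
  qed auto
  have r: "mat 2 (2 * n) (\<lambda>(i, j). ?M $$ (i + 2 * n, j)) = ?r"
  proof (rule eq_matI)
    fix i j assume ij: "i < dim_row ?r" "j < dim_col ?r"
    hence i: "i = 0 \<or> i = 1" and j: "j < 2 * n" by auto
    have d: "(i + 2 * n) div 2 = n" "(i + 2 * n) mod 2 = i" using i by auto
    show "mat 2 (2 * n) (\<lambda>(i, j). ?M $$ (i + 2 * n, j)) $$ (i, j) = ?r $$ (i, j)"
      using i j d small[OF j] by (auto simp: block_mat2_def)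
  qed auto
  have d: "mat 2 2 (\<lambda>(i, j). ?M $$ (i + 2 * n, j + 2 * n)) = 0\<^sub>m 2 2"
  proof (rule eq_matI)
    fix i j assume ij: "i < dim_row (0\<^sub>m 2 2 :: complex mat)" "j < dim_col (0\<^sub>m 2 2 :: complex mat)"
    hence i: "i = 0 \<or> i = 1" and j: "j = 0 \<or> j = 1" by auto
    have d: "(i + 2 * n) div 2 = n" "(i + 2 * n) mod 2 = i"
      "(j + 2 * n) div 2 = n" "(j + 2 * n) mod 2 = j" using i j by auto
    show "mat 2 2 (\<lambda>(i, j). ?M $$ (i + 2 * n, j + 2 * n)) $$ (i, j) = 0\<^sub>m 2 2 $$ (i, j)"
      using ij d \<open>n \<ge> 1\<close> by (auto simp: block_mat2_def)
  qed auto
  have dims: "dim_row ?M - 2 * n = 2" "dim_col ?M - 2 * n = 2"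
    by (simp_all add: block_mat2_def)
  have split: "split_block ?M (2 * n) (2 * n) = (?W, ?c, ?r, 0\<^sub>m 2 2)"
    unfolding split_block_def Let_def dims W c r d ..
  have Q: "?r * mat_inv ?W * ?c \<in> carrier_mat 2 2" by auto
  show ?thesis
    unfolding quasi_wronskian_def quasidet_last_def dim split prod.case
    using Q by (intro eq_matI) auto
qed


subsection \<open>Gauge fields\<close>

definition mat_differentiable :: "(real^4 \<Rightarrow> complex mat) \<Rightarrow> real^4 \<Rightarrow> bool" where
  "mat_differentiable F x \<longleftrightarrow> (\<forall>i<2. \<forall>j<2. (\<lambda>y. F y $$ (i, j)) differentiable (at x))"

text \<open>Entrywise partial derivative $\partial_\mu$ of a $2 \times 2$ matrix function.\<close>

definition partial :: "4 \<Rightarrow> (real^4 \<Rightarrow> complex mat) \<Rightarrow> real^4 \<Rightarrow> complex mat" where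
  "partial \<mu> F x =
     mat 2 2 (\<lambda>(i, j). vector_derivative (\<lambda>t. F (x + t *\<^sub>R axis \<mu> 1) $$ (i, j)) (at 0))"

definition gauge_field :: "(real^4 \<Rightarrow> complex mat) \<Rightarrow> 4 \<Rightarrow> real^4 \<Rightarrow> complex mat" where
  "gauge_field J \<mu> x =
     (if \<mu> = 1 \<or> \<mu> = 3
      then (- 1 / 2) \<cdot>\<^sub>m (partial 1 J x * mat_inv (J x) + partial 3 J x * mat_inv (J x))
      else (- 1 / 2) \<cdot>\<^sub>m (partial 2 J x * mat_inv (J x) + partial 4 J x * mat_inv (J x)))"


subsection \<open>The group SU(2) and its Lie algebra\<close>

definition SU2 :: "complex mat set" where
  "SU2 = {U \<in> carrier_mat 2 2. mat_adjoint U * U = 1\<^sub>m 2 \<and> Determinant.det U = 1}"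

text \<open>The Lie algebra of a closed subgroup of $GL(d, C)$: the velocities at 0 of its
  one-parameter subgroups, that is the $X$ with $\exp(tX)$ in the group for all real $t$.\<close>

definition lie_algebra :: "nat \<Rightarrow> complex mat set \<Rightarrow> complex mat set" where
  "lie_algebra d G = {X \<in> carrier_mat d d. \<exists>\<gamma> :: real \<Rightarrow> complex mat.
     (\<forall>t. \<gamma> t \<in> G) \<and> \<gamma> 0 = 1\<^sub>m d \<and> (\<forall>s t. \<gamma> (s + t) = \<gamma> s * \<gamma> t) \<and>
     (\<forall>i<d. \<forall>j<d. ((\<lambda>t. \<gamma> t $$ (i, j)) has_vector_derivative X $$ (i, j)) (at 0))}"

end

theory Submission
  imports Defs
begin

text \<open>A complex $2 \times 2$ matrix of the form \<open>quat p q\<close> is a quaternion with squared norm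
  $|p|^2 + |q|^2 = \det$. All blocks of the Wronski matrix $W$ are quaternions, so $W^{-1}$ and $J$ are
  quaternionic too. Block row shifting gives $C W = W D$, where $D$ is the diagonal matrix of the
  $\lambda_i, \overline\lambda_i$ and $C$ is a block companion matrix whose corner block is $-J$;
  hence $\det J = \det C = \det D = \prod_i |\lambda_i|^2$. So $J$ moves on a sphere of constant
  radius in the quaternions, and every $(\partial_\mu J) J^{-1}$ is a purely imaginary quaternion,
  that is an element of $su(2)$.\<close>

subsection \<open>Quaternions as $2 \times 2$ matrices\<close>

lemma less_2_iff: "i < 2 \<longleftrightarrow> i = 0 \<or> i = (1::nat)"
  by auto

lemma mat2_carrier [simp]: "mat2 a b c d \<in> carrier_mat 2 2"
  by (simp add: mat2_def mat_of_rows_list_def numeral_2_eq_2)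

lemma mat2_dim [simp]: "dim_row (mat2 a b c d) = 2" "dim_col (mat2 a b c d) = 2"
  using mat2_carrier by (metis carrier_matD)+

lemma mat2_index [simp]:
  "mat2 a b c d $$ (0, 0) = a" "mat2 a b c d $$ (0, Suc 0) = b"
  "mat2 a b c d $$ (Suc 0, 0) = c" "mat2 a b c d $$ (Suc 0, Suc 0) = d"
  by (simp_all add: mat2_def mat_of_rows_list_def)

lemma mat2_eq_iff:
  assumes "M \<in> carrier_mat 2 2"
  shows "M = mat2 a b c d \<longleftrightarrow>
    M $$ (0, 0) = a \<and> M $$ (0, 1) = b \<and> M $$ (1, 0) = c \<and> M $$ (1, 1) = d"
  using assms by (auto simp: mat_eq_iff less_2_iff)

lemma mat2_mult:
  "mat2 a b c d * mat2 a' b' c' d' =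
     mat2 (a * a' + b * c') (a * b' + b * d') (c * a' + d * c') (c * b' + d * d')"
  by (subst mat2_eq_iff)
     (auto intro: mult_carrier_mat[of _ 2 2] simp: scalar_prod_def numeral_2_eq_2)

lemma mat2_one: "1\<^sub>m 2 = mat2 1 0 0 1"
  by (subst mat2_eq_iff) auto

lemma mat2_inject: "mat2 a b c d = mat2 a' b' c' d' \<longleftrightarrow> a = a' \<and> b = b' \<and> c = c' \<and> d = d'"
  by (subst mat2_eq_iff) auto

lemma mat2_diag_power: "mat2 a 0 0 d ^\<^sub>m k = mat2 (a ^ k) 0 0 (d ^ k)"
  by (induction k) (simp_all add: mat2_one mat2_mult mult.commute)

lemma mat2_det: "Determinant.det (mat2 a b c d) = a * d - b * c"
proof -
  have "Determinant.det (mat2 a b c d) =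
      (\<Sum>i<2. mat2 a b c d $$ (i, 0) * cofactor (mat2 a b c d) i 0)"
    by (rule laplace_expansion_column) auto
  also have "\<dots> = a * d - b * c"
    by (auto simp: cofactor_def numeral_2_eq_2 mat_delete_def det_single)
  finally show ?thesis .
qed

text \<open>The parameters are the first column, so that a seed block \<open>\<psi> i\<close> of the
  theorem is \<open>quat (A i) (- B i)\<close>.\<close>

definition quat :: "complex \<Rightarrow> complex \<Rightarrow> complex mat" where
  "quat p q = mat2 p (- cnj q) q (cnj p)"

lemma quat_carrier [simp]: "quat p q \<in> carrier_mat 2 2"
  by (simp add: quat_def)

lemma quat_index [simp]:
  "quat p q $$ (0, 0) = p" "quat p q $$ (0, Suc 0) = - cnj q"
  "quat p q $$ (Suc 0, 0) = q" "quat p q $$ (Suc 0, Suc 0) = cnj p"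
  by (simp_all add: quat_def)

lemma quat_mult: "quat p q * quat p' q' = quat (p * p' - cnj q * q') (q * p' + cnj p * q')"
  by (simp add: quat_def mat2_mult mat2_inject algebra_simps)

lemma quat_add: "quat p q + quat p' q' = quat (p + p') (q + q')"
  unfolding quat_def by (subst mat2_eq_iff) auto

lemma quat_smult: "of_real k \<cdot>\<^sub>m quat p q = quat (of_real k * p) (of_real k * q)"
  unfolding quat_def by (subst mat2_eq_iff) auto

lemma quat_adjoint: "mat_adjoint (quat p q) = quat (cnj p) (- q)"
  unfolding quat_def by (subst mat2_eq_iff) (auto simp: mat_adjoint_def mat_of_rows_def quat_def)

lemma quat_uminus: "- quat p q = quat (- p) (- q)"
  unfolding quat_def by (subst mat2_eq_iff) auto

lemma quat_one: "1\<^sub>m 2 = quat 1 0"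
  by (simp add: mat2_one quat_def)

lemma quat_trace: "mat_trace (quat p q) = of_real (2 * Re p)"
  by (simp add: mat_trace_def quat_def numeral_2_eq_2 complex_eq_iff)

lemma quat_det: "Determinant.det (quat p q) = of_real ((cmod p)\<^sup>2 + (cmod q)\<^sup>2)"
  by (simp add: quat_def mat2_det mult.commute flip: complex_norm_square)

lemma quat_adjoint_mult:
  "quat (cnj p) (- q) * quat p q = quat (of_real ((cmod p)\<^sup>2 + (cmod q)\<^sup>2)) 0"
  by (simp add: quat_mult mult.commute flip: complex_norm_square)

lemma quat_in_SU2: "(cmod p)\<^sup>2 + (cmod q)\<^sup>2 = 1 \<Longrightarrow> quat p q \<in> SU2"
  by (simp add: SU2_def quat_adjoint quat_adjoint_mult quat_det quat_one del: of_real_add)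

subsection \<open>Inverse matrices\<close>

lemma inverse_unique_mat:
  fixes M :: "'a :: semiring_1 mat"
  assumes "M \<in> carrier_mat n n" "X \<in> carrier_mat n n" "Y \<in> carrier_mat n n"
    and "X * M = 1\<^sub>m n" "M * Y = 1\<^sub>m n"
  shows "X = Y"
proof -
  have "X = X * (M * Y)"
    unfolding assms(5) by (rule right_mult_one_mat[OF assms(2), symmetric])
  also have "\<dots> = X * M * Y"
    by (rule assoc_mult_mat[OF assms(2,1,3), symmetric])
  also have "\<dots> = Y"
    unfolding assms(4) by (rule left_mult_one_mat[OF assms(3)])
  finally show ?thesis .
qed

lemma invertible_matI:
  assumes "M \<in> carrier_mat n n" "Y \<in> carrier_mat n n" "M * Y = 1\<^sub>m n" "Y * M = 1\<^sub>m n"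
  shows "invertible_mat M"
  using assms unfolding invertible_mat_def inverts_mat_def by auto

lemma invertible_mat_iff_det:
  fixes M :: "'a :: field mat"
  assumes M: "M \<in> carrier_mat n n"
  shows "invertible_mat M \<longleftrightarrow> Determinant.det M \<noteq> 0"
proof
  assume "invertible_mat M"
  then obtain Y where Y: "M * Y = 1\<^sub>m n" "Y * M = 1\<^sub>m (dim_row Y)"
    using M unfolding invertible_mat_def inverts_mat_def by auto
  \<comment> \<open>\<open>invertible_mat\<close> leaves the shape of the inverse open; it is read
    off from the two products.\<close>
  have "dim_col Y = n"
    using arg_cong[OF Y(1), of dim_col] by simp
  moreover have "dim_row Y = n"
    using arg_cong[OF Y(2), of dim_col] M by simp
  ultimately have "Determinant.det M * Determinant.det Y = 1"
    using det_mult[OF M, of Y] Y(1) by auto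
  then show "Determinant.det M \<noteq> 0"
    by auto
next
  assume d: "Determinant.det M \<noteq> 0"
  show "invertible_mat M"
    using det_non_zero_imp_unit[OF M d, of b] M
    by (auto simp: Units_def ring_mat_def intro: invertible_matI[of _ n])
qed

lemma
  assumes M: "M \<in> carrier_mat n n" and inv: "invertible_mat M"
  shows mat_inv_carrier: "mat_inv M \<in> carrier_mat n n"
    and mult_mat_inv: "M * mat_inv M = 1\<^sub>m n"
    and mat_inv_mult: "mat_inv M * M = 1\<^sub>m n"
proof -
  \<comment> \<open>\<open>mat_inv\<close> is \<open>the\<close> of an option, so
    \<open>None\<close> has to be excluded first; the nonzero determinant does this.\<close>
  have "mat_inverse M \<noteq> None"
    using mat_inverse(1)[OF M] det_non_zero_imp_unit[OF M] inv invertible_mat_iff_det[OF M]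
    by metis
  then obtain Y where "mat_inverse M = Some Y"
    by blast
  with mat_inverse(2)[OF M this]
  show "mat_inv M \<in> carrier_mat n n" "M * mat_inv M = 1\<^sub>m n" "mat_inv M * M = 1\<^sub>m n"
    by (auto simp: mat_inv_def)
qed

lemma mat_inv_eqI:
  assumes "M \<in> carrier_mat n n" "Y \<in> carrier_mat n n" "M * Y = 1\<^sub>m n" "Y * M = 1\<^sub>m n"
  shows "mat_inv M = Y"
  using invertible_matI[OF assms] assms
  by (blast intro: inverse_unique_mat mat_inv_carrier mat_inv_mult)

text \<open>Cramer's rule. It makes the entries of the inverse rational functions of the entries of
  \<open>M\<close>, from which their differentiability follows later.\<close>

lemma mat_inv_eq_adj_mat:
  assumes M: "M \<in> carrier_mat n n" and d: "Determinant.det M \<noteq> 0"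
  shows "mat_inv M = inverse (Determinant.det M) \<cdot>\<^sub>m adj_mat M"
proof (rule mat_inv_eqI[OF M])
  show "M * (inverse (Determinant.det M) \<cdot>\<^sub>m adj_mat M) = 1\<^sub>m n"
    "inverse (Determinant.det M) \<cdot>\<^sub>m adj_mat M * M = 1\<^sub>m n"
    using adj_mat[OF M] M d
    by (auto simp: mult_smult_distrib[OF M] mult_smult_assoc_mat[of _ n n] intro!: eq_matI)
qed (use adj_mat[OF M] in simp)

subsection \<open>Imaginary quaternions as the Lie algebra of SU(2)\<close>

text \<open>For a quaternion, \<open>Re p = 0\<close> amounts both to being anti-Hermitian and to
  being traceless: the off-diagonal entries \<open>- cnj q\<close> and \<open>q\<close> already have
  the anti-Hermitian form.\<close>

definition su2 :: "complex mat set" where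
  "su2 = {quat p q | p q. Re p = 0}"

lemma su2_add: "X \<in> su2 \<Longrightarrow> Y \<in> su2 \<Longrightarrow> X + Y \<in> su2"
  by (fastforce simp: su2_def quat_add)

lemma su2_smult: "X \<in> su2 \<Longrightarrow> of_real k \<cdot>\<^sub>m X \<in> su2"
  by (fastforce simp: su2_def quat_smult)

lemma su2_adjoint: "X \<in> su2 \<Longrightarrow> mat_adjoint X = - X"
  by (auto simp: su2_def quat_adjoint quat_uminus complex_eq_iff intro!: arg_cong2[of _ _ _ _ quat])

lemma su2_trace: "X \<in> su2 \<Longrightarrow> mat_trace X = 0"
  by (auto simp: su2_def quat_trace)

text \<open>An imaginary quaternion X of norm w satisfies X^2 = - w^2, so exp(tX) = cos(wt) +
  (sin(wt) / w) X. This explicit curve \<open>\<gamma>\<close> is the one-parameter subgroup that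
  \<open>lie_algebra\<close> asks for.\<close>

lemma su2_subset_lie_algebra: "su2 \<subseteq> lie_algebra 2 SU2"
proof
  fix X assume "X \<in> su2"
  then obtain p q where X: "X = quat p q" and "Re p = 0"
    by (auto simp: su2_def)
  then have cnj_p: "cnj p = - p"
    by (simp add: complex_eq_iff)
  define w where "w = sqrt ((cmod p)\<^sup>2 + (cmod q)\<^sup>2)"
  define c where "c t = cos (w * t)" for t
  \<comment> \<open>For \<open>w = 0\<close> the quotient is 0 by convention instead of the limit t.
    Then X = 0 as well, and the curve is constantly 1, as it should be.\<close>
  define s where "s t = sin (w * t) / w" for t
  define \<gamma> where "\<gamma> t = quat (of_real (c t) + p * of_real (s t)) (q * of_real (s t))" for t
  have w2: "w\<^sup>2 = (cmod p)\<^sup>2 + (cmod q)\<^sup>2"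
    by (simp add: w_def)
  \<comment> \<open>The first entry of X^2 = - w^2; it removes the square of \<open>p\<close> from
    the product in the addition law of \<open>\<gamma>\<close>.\<close>
  have w2': "p * p = cnj q * q - of_real (w * w)"
  proof -
    have "p * p = - (p * cnj p)" "cnj q * q = q * cnj q"
      by (simp_all add: cnj_p)
    then show ?thesis
      by (simp add: w2 flip: complex_norm_square power2_eq_square)
  qed
  have w0: "p = 0" "q = 0" if "w = 0"
    using that by (auto simp: w_def add_nonneg_eq_0_iff)
  have ws: "w * s t = sin (w * t)" for t
    using w0 by (simp add: s_def)
  have c_add: "c (t + u) = c t * c u - w * w * s t * s u" for t u
    using ws[of t] ws[of u] by (simp add: c_def distrib_left cos_add algebra_simps flip: ws)
  have s_add: "s (t + u) = s t * c u + c t * s u" for t u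
    by (simp add: c_def s_def distrib_left sin_add add_divide_distrib)
  have "\<gamma> t \<in> SU2" for t
    unfolding \<gamma>_def
  proof (rule quat_in_SU2)
    have "(cmod (of_real (c t) + p * of_real (s t)))\<^sup>2 = (c t)\<^sup>2 + (cmod p)\<^sup>2 * (s t)\<^sup>2"
      using \<open>Re p = 0\<close> by (simp add: cmod_power2 power_mult_distrib)
    moreover have "(c t)\<^sup>2 + w\<^sup>2 * (s t)\<^sup>2 = 1"
      by (simp add: c_def ws flip: power_mult_distrib)
    ultimately show "(cmod (of_real (c t) + p * of_real (s t)))\<^sup>2 + (cmod (q * of_real (s t)))\<^sup>2 = 1"
      by (simp add: w2 norm_mult power_mult_distrib distrib_right)
  qed
  moreover have "\<gamma> 0 = 1\<^sub>m 2"
    by (simp add: \<gamma>_def quat_one c_def s_def)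
  moreover have "\<gamma> (t + u) = \<gamma> t * \<gamma> u" for t u
  proof -
    have "(of_real (c t) + p * of_real (s t)) * (of_real (c u) + p * of_real (s u)) =
        of_real (c t * c u) + p * of_real (s t * c u + c t * s u) + p * p * of_real (s t * s u)"
      by (simp add: algebra_simps)
    then show ?thesis
      unfolding \<gamma>_def quat_mult c_add s_add w2'
      by (intro arg_cong2[of _ _ _ _ quat]) (simp_all add: cnj_p algebra_simps)
  qed
  moreover have "((\<lambda>t. \<gamma> t $$ (i, j)) has_vector_derivative X $$ (i, j)) (at 0)"
    if "i < 2" "j < 2" for i j
  proof -
    have "(c has_real_derivative 0) (at 0)"
      unfolding c_def by (auto intro!: derivative_eq_intros)
    then have c': "((\<lambda>t. of_real (c t)) has_vector_derivative 0) (at 0)"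
      by (metis has_real_derivative_iff_has_vector_derivative has_vector_derivative_of_real of_real_0)
    \<comment> \<open>For \<open>w = 0\<close> the derivative of \<open>s\<close> is 0 instead of 1;
      the factors \<open>p\<close> and \<open>q\<close> vanish then, so the products with
      \<open>s\<close> still have the expected derivatives.\<close>
    have "(s has_real_derivative (if w = 0 then 0 else 1)) (at 0)"
      unfolding s_def by (auto intro!: derivative_eq_intros)
    then have s0: "((\<lambda>t. k * of_real (s t)) has_vector_derivative k * of_real (if w = 0 then 0 else 1)) (at 0)"
      for k :: complex
      by (intro has_vector_derivative_mult_right has_vector_derivative_of_real)
    have s': "((\<lambda>t. k * of_real (s t)) has_vector_derivative k) (at 0)" if "w = 0 \<longrightarrow> k = 0"
      for k :: complex
      using s0[of k] that by (cases "w = 0") simp_all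
    show ?thesis
      using that s'[of q] s'[of "- cnj q"] w0
        has_vector_derivative_add[OF c' s'[of p]] has_vector_derivative_add[OF c' s'[of "cnj p"]]
      by (auto simp: \<gamma>_def X less_2_iff)
  qed
  ultimately show "X \<in> lie_algebra 2 SU2"
    unfolding lie_algebra_def mem_Collect_eq by (intro conjI exI[of _ \<gamma>] allI impI) (simp_all add: X)
qed

subsection \<open>Quaternionic block matrices\<close>

text \<open>\<open>quat_conj M\<close> is $S \overline{M} S^{-1}$ for the block diagonal $S$ with blocks
  $[[0, -1], [1, 0]]$, so its fixed points are the matrices whose
  $2 \times 2$ blocks are quaternions.\<close>

definition partner :: "nat \<Rightarrow> nat" where
  "partner i = (if even i then i + 1 else i - 1)"

text \<open>Row \<open>i\<close> of S has its only nonzero entry in column \<open>partner i\<close>,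
  and this entry is minus \<open>parity_sign i\<close>; the minus signs from S and from its inverse
  cancel in \<open>quat_conj\<close>.\<close>

definition parity_sign :: "nat \<Rightarrow> complex" where
  "parity_sign i = (if even i then 1 else - 1)"

definition quat_conj :: "complex mat \<Rightarrow> complex mat" where
  "quat_conj M = mat (dim_row M) (dim_col M)
     (\<lambda>(i, j). parity_sign i * parity_sign j * cnj (M $$ (partner i, partner j)))"

lemma partner_less_iff: "even m \<Longrightarrow> partner i < m \<longleftrightarrow> i < m"
  unfolding partner_def by presburger

lemma partner_partner [simp]: "partner (partner i) = i"
  by (auto simp: partner_def)

lemma partner_div_mod [simp]: "partner i div 2 = i div 2" "even (partner i) \<longleftrightarrow> odd i"
    "partner i mod 2 = partner (i mod 2)"
  by (auto simp: partner_def, presburger+)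

lemma partner_inj [simp]: "partner i = partner j \<longleftrightarrow> i = j"
  by (metis partner_partner)

lemma parity_sign_square [simp]: "parity_sign i * parity_sign i = 1"
  by (simp add: parity_sign_def)

lemma parity_sign_mod [simp]: "parity_sign (i mod 2) = parity_sign i"
  by (simp add: parity_sign_def)

lemma quat_conj_dim [simp]: "dim_row (quat_conj M) = dim_row M" "dim_col (quat_conj M) = dim_col M"
  by (simp_all add: quat_conj_def)

lemma quat_conj_index [simp]:
  "i < dim_row M \<Longrightarrow> j < dim_col M \<Longrightarrow>
    quat_conj M $$ (i, j) = parity_sign i * parity_sign j * cnj (M $$ (partner i, partner j))"
  by (simp add: quat_conj_def)

lemma quat_conj_carrier: "M \<in> carrier_mat k l \<Longrightarrow> quat_conj M \<in> carrier_mat k l"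
  by (intro carrier_matI) auto

lemma quat_conj_one: "even k \<Longrightarrow> quat_conj (1\<^sub>m k) = 1\<^sub>m k"
  by (rule eq_matI) (simp_all add: partner_less_iff)

text \<open>Entrywise complex conjugation and conjugation by S are both multiplicative. In
  coordinates, the summation index is replaced by its partner, which stays in range because the
  dimension is even, and the two signs at that index cancel.\<close>

lemma quat_conj_mult:
  assumes "M \<in> carrier_mat k l" "N \<in> carrier_mat l m" "even k" "even l" "even m"
  shows "quat_conj (M * N) = quat_conj M * quat_conj N"
proof (rule eq_matI)
  fix i j assume "i < dim_row (quat_conj M * quat_conj N)" "j < dim_col (quat_conj M * quat_conj N)"
  then have ij: "i < k" "j < m"
    using assms by auto
  have "quat_conj (M * N) $$ (i, j) =
      (\<Sum>r<l. parity_sign i * parity_sign j * cnj (M $$ (partner i, r) * N $$ (r, partner j)))"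
    using ij assms
    by (simp add: partner_less_iff scalar_prod_def sum_distrib_left atLeast0LessThan)
  also have "\<dots> = (\<Sum>r<l. parity_sign i * parity_sign j *
      cnj (M $$ (partner i, partner r) * N $$ (partner r, partner j)))"
    by (rule sum.reindex_bij_witness[of _ partner partner]) (simp_all add: partner_less_iff \<open>even l\<close>)
  also have "\<dots> = (\<Sum>r<l. quat_conj M $$ (i, r) * quat_conj N $$ (r, j))"
  proof (rule sum.cong)
    fix r assume "r \<in> {..<l}"
    then have "quat_conj M $$ (i, r) * quat_conj N $$ (r, j) =
        (parity_sign r * parity_sign r) * (parity_sign i * parity_sign j *
        cnj (M $$ (partner i, partner r) * N $$ (partner r, partner j)))"
      using ij assms by simp
    then show "parity_sign i * parity_sign j *
        cnj (M $$ (partner i, partner r) * N $$ (partner r, partner j)) =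
        quat_conj M $$ (i, r) * quat_conj N $$ (r, j)"
      by simp
  qed simp
  also have "\<dots> = (quat_conj M * quat_conj N) $$ (i, j)"
    using ij assms by (simp add: scalar_prod_def atLeast0LessThan)
  finally show "quat_conj (M * N) $$ (i, j) = (quat_conj M * quat_conj N) $$ (i, j)" .
qed (use assms in auto)

lemma quat_conj_uminus: 
  assumes "M \<in> carrier_mat k l" "even k" "even l"
  shows "quat_conj (- M) = - quat_conj M"
  using assms by (intro eq_matI) (auto simp: partner_less_iff)

text \<open>Applying \<open>quat_conj\<close> to the identity
  \<open>mat_inv M * M = 1\<^sub>m k\<close> gives a second left inverse of \<open>M\<close>, and
  inverses are unique.\<close>

lemma quat_conj_mat_inv:
  assumes M: "M \<in> carrier_mat k k" and k: "even k" and inv: "invertible_mat M"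
    and fixed: "quat_conj M = M"
  shows "quat_conj (mat_inv M) = mat_inv M"
proof (rule inverse_unique_mat[OF M])
  note I = mat_inv_carrier[OF M inv]
  show "quat_conj (mat_inv M) * M = 1\<^sub>m k"
    using quat_conj_mult[OF I M k k k] mat_inv_mult[OF M inv] quat_conj_one[OF k] fixed by simp
qed (use mat_inv_carrier[OF M inv] mult_mat_inv[OF M inv] quat_conj_carrier in auto)

lemma quat_conj_fixed_iff_quat:
  assumes "M \<in> carrier_mat 2 2" "quat_conj M = M"
  shows "M = quat (M $$ (0, 0)) (M $$ (1, 0))"
proof -
  have "M $$ (i, j) = parity_sign i * parity_sign j * cnj (M $$ (partner i, partner j))"
    if "i < 2" "j < 2" for i j
    using quat_conj_index[of i M j] that assms by auto
  from this[of 0 1] this[of 1 1] show ?thesis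
    using assms(1) unfolding quat_def by (subst mat2_eq_iff) (auto simp: partner_def parity_sign_def)
qed

text \<open>This is the invariance of a quaternion under \<open>quat_conj\<close>, with the signs
  moved to the other side.\<close>

lemma quat_partner:
  assumes "a < 2" "b < 2"
  shows "cnj (quat p q $$ (partner a, partner b)) = parity_sign a * parity_sign b * quat p q $$ (a, b)"
  using assms by (auto simp: less_2_iff partner_def parity_sign_def)

subsection \<open>The quasi-Wronskian of a quaternionic seed\<close>

text \<open>The algebra rests on quaternionic seed blocks and on nonzero eigenvalues in conjugate
  pairs; differentiability of \<open>p\<close> and \<open>q\<close> is added only for the gauge
  fields.\<close>

locale quaternionic_seed =
  fixes n :: nat and p q :: "nat \<Rightarrow> real^4 \<Rightarrow> complex" and lam :: "nat \<Rightarrow> complex"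
    and \<psi> :: "nat \<Rightarrow> real^4 \<Rightarrow> complex mat" and \<Lambda> :: "nat \<Rightarrow> complex mat"
  assumes n_pos: "n \<ge> 1"
    and lam_nonzero: "s \<in> {1..n} \<Longrightarrow> lam s \<noteq> 0"
    and \<psi>_eq: "s \<in> {1..n} \<Longrightarrow> \<psi> s x = quat (p s x) (q s x)"
    and \<Lambda>_eq: "s \<in> {1..n} \<Longrightarrow> \<Lambda> s = mat2 (lam s) 0 0 (cnj (lam s))"
begin

text \<open>The diagonal of D: each \<lambda> followed by its conjugate. Scalar indices start at 0
  and block indices at 1, hence \<open>j div 2 + 1\<close>.\<close>

definition spec :: "nat \<Rightarrow> complex" where
  "spec j = (if even j then lam (j div 2 + 1) else cnj (lam (j div 2 + 1)))"

abbreviation seed :: "real^4 \<Rightarrow> nat \<Rightarrow> nat \<Rightarrow> complex" where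
  "seed x i j \<equiv> quat (p (j div 2 + 1) x) (q (j div 2 + 1) x) $$ (i mod 2, j mod 2)"

definition last_row :: "real^4 \<Rightarrow> complex mat" where
  "last_row x = mat 2 (2 * n) (\<lambda>(i, j). seed x i j * spec j ^ n)"

definition first_col :: "complex mat" where
  "first_col = mat (2 * n) 2 (\<lambda>(i, j). if i = j then 1 else 0)"

lemma spec_nonzero: "j < 2 * n \<Longrightarrow> spec j \<noteq> 0"
  using lam_nonzero[of "j div 2 + 1"] by (auto simp: spec_def)

lemma spec_partner: "spec (partner j) = cnj (spec j)"
  by (simp add: spec_def)

lemma seed_partner: "cnj (seed x (partner i) (partner j)) = parity_sign i * parity_sign j * seed x i j"
  using quat_partner[of "i mod 2" "j mod 2"] by simp

text \<open>Right multiplication by a power of a diagonal matrix scales the columns. Block powers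
  thus become scalar powers of \<open>spec\<close>, as in a Vandermonde matrix.\<close>

lemma seed_power_index:
  assumes "j < 2 * n" "i < 2"
  shows "(\<psi> (j div 2 + 1) x * \<Lambda> (j div 2 + 1) ^\<^sub>m k) $$ (i, j mod 2) = seed x i j * spec j ^ k"
proof -
  have s: "j div 2 + 1 \<in> {1..n}" and b: "j mod 2 = (if even j then 0 else 1)"
    using assms by (auto simp: mod2_eq_if)
  show ?thesis
    using assms(2) b unfolding \<psi>_eq[OF s] \<Lambda>_eq[OF s] mat2_diag_power spec_def quat_def mat2_mult
    by (auto simp: less_2_iff)
qed

lemma wronski_carrier [simp]: "wronski_mat n \<psi> \<Lambda> x \<in> carrier_mat (2 * n) (2 * n)"
  by (simp add: wronski_mat_def block_mat2_def)

lemma wronski_dim [simp]: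
  "dim_row (wronski_mat n \<psi> \<Lambda> x) = 2 * n" "dim_col (wronski_mat n \<psi> \<Lambda> x) = 2 * n"
  using wronski_carrier carrier_matD by blast+

lemma wronski_index:
  "i < 2 * n \<Longrightarrow> j < 2 * n \<Longrightarrow> wronski_mat n \<psi> \<Lambda> x $$ (i, j) = seed x i j * spec j ^ (i div 2)"
  using seed_power_index[of j "i mod 2" x "i div 2"] by (simp add: wronski_mat_def block_mat2_def)

lemma last_row_carrier [simp]: "last_row x \<in> carrier_mat 2 (2 * n)"
  by (simp add: last_row_def)

lemma first_col_carrier [simp]: "first_col \<in> carrier_mat (2 * n) 2"
  by (simp add: first_col_def)

lemma quasi_wronskian_eq_mult:
  assumes "invertible_mat (wronski_mat n \<psi> \<Lambda> x)"
  shows "quasi_wronskian n \<psi> \<Lambda> x = - (last_row x * mat_inv (wronski_mat n \<psi> \<Lambda> x) * first_col)"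
proof -
  have "mat 2 (2 * n) (\<lambda>(i, j). (\<psi> (j div 2 + 1) x * \<Lambda> (j div 2 + 1) ^\<^sub>m n) $$ (i, j mod 2)) = last_row x"
    unfolding last_row_def by (rule cong_mat) (auto simp: seed_power_index[simplified])
  then show ?thesis
    using quasi_wronskian_eq[OF n_pos assms] by (simp add: first_col_def)
qed

section \<open>Quaternionic invariance of the Wronski matrix and of J\<close>

text \<open>Passing to partners conjugates \<open>spec j\<close> and leaves the exponent
  \<open>i div 2\<close> alone, so the invariance of the seed blocks carries over.\<close>

lemma quat_conj_wronski: "quat_conj (wronski_mat n \<psi> \<Lambda> x) = wronski_mat n \<psi> \<Lambda> x" (is "quat_conj ?W = _")
proof (rule eq_matI)
  fix i j assume "i < dim_row ?W" "j < dim_col ?W"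
  then have ij: "i < 2 * n" "j < 2 * n"
    using wronski_carrier[of x] by auto
  then have "quat_conj ?W $$ (i, j) =
      parity_sign i * parity_sign j * (cnj (seed x (partner i) (partner j)) * spec j ^ (i div 2))"
    using wronski_carrier[of x]
    by (simp add: wronski_index partner_less_iff spec_partner)
  also have "\<dots> = ?W $$ (i, j) * (parity_sign i * parity_sign i) * (parity_sign j * parity_sign j)"
    unfolding seed_partner using ij by (simp only: wronski_index mult_ac)
  finally show "quat_conj ?W $$ (i, j) = ?W $$ (i, j)"
    by simp
qed auto

lemma quat_conj_last_row: "quat_conj (last_row x) = last_row x"
proof (rule eq_matI)
  fix i j assume "i < dim_row (last_row x)" "j < dim_col (last_row x)"
  then have ij: "i < 2" "j < 2 * n"
    by (auto simp: last_row_def)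
  then have "quat_conj (last_row x) $$ (i, j) =
      parity_sign i * parity_sign j * (cnj (seed x (partner i) (partner j)) * spec j ^ n)"
    by (simp add: last_row_def partner_less_iff spec_partner)
  also have "\<dots> = last_row x $$ (i, j) * (parity_sign i * parity_sign i) * (parity_sign j * parity_sign j)"
    unfolding seed_partner using ij by (simp add: last_row_def mult_ac del: parity_sign_square)
  finally show "quat_conj (last_row x) $$ (i, j) = last_row x $$ (i, j)"
    by simp
qed auto

lemma quat_conj_first_col: "quat_conj first_col = first_col"
  by (rule eq_matI) (auto simp: first_col_def partner_less_iff)

text \<open>The fixed points of \<open>quat_conj\<close> are closed under products, inverses and
  negation, and all factors of J are fixed.\<close>

lemma quat_conj_quasi_wronskian:
  assumes "invertible_mat (wronski_mat n \<psi> \<Lambda> x)"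
  shows "quat_conj (quasi_wronskian n \<psi> \<Lambda> x) = quasi_wronskian n \<psi> \<Lambda> x"
proof -
  note I = mat_inv_carrier[OF wronski_carrier assms]
  have "quat_conj (last_row x * mat_inv (wronski_mat n \<psi> \<Lambda> x)) =
      last_row x * mat_inv (wronski_mat n \<psi> \<Lambda> x)"
    using quat_conj_mult[OF last_row_carrier I] quat_conj_last_row
      quat_conj_mat_inv[OF wronski_carrier _ assms quat_conj_wronski] by simp
  then have "quat_conj (last_row x * mat_inv (wronski_mat n \<psi> \<Lambda> x) * first_col) =
      last_row x * mat_inv (wronski_mat n \<psi> \<Lambda> x) * first_col"
    using quat_conj_mult[OF mult_carrier_mat[OF last_row_carrier I] first_col_carrier]
      quat_conj_first_col by simp
  then show ?thesis
    unfolding quasi_wronskian_eq_mult[OF assms]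
    using quat_conj_uminus[OF mult_carrier_mat[OF mult_carrier_mat[OF last_row_carrier I] first_col_carrier]]
    by simp
qed

lemma quasi_wronskian_carrier:
  assumes "invertible_mat (wronski_mat n \<psi> \<Lambda> x)"
  shows "quasi_wronskian n \<psi> \<Lambda> x \<in> carrier_mat 2 2"
  using mat_inv_carrier[OF wronski_carrier assms] unfolding quasi_wronskian_eq_mult[OF assms]
  by (auto simp: last_row_def first_col_def)

section \<open>The determinant of J\<close>

text \<open>Cancelling det W in C W = V, where V is W D with permuted rows, gives det C = det D. The
  upper left block of C is -J and the blocks below it vanish up to an identity matrix, so det C =
  det J.\<close>

lemma det_quasi_wronskian:
  assumes inv: "invertible_mat (wronski_mat n \<psi> \<Lambda> x)"
  shows "Determinant.det (quasi_wronskian n \<psi> \<Lambda> x) = (\<Prod>j<2 * n. spec j)"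
proof -
  let ?W = "wronski_mat n \<psi> \<Lambda> x"
  note I = mat_inv_carrier[OF wronski_carrier inv]
  define R where "R = last_row x * mat_inv ?W"
  define C where "C = mat (2 * n) (2 * n) (\<lambda>(i, j). if i < 2 then R $$ (i, j) else if i = j then 1 else 0)"
  define D where "D = mat (2 * n) (2 * n) (\<lambda>(i, j). if i = j then spec j else 0)"
  \<comment> \<open>The nested conditional is the row rotation in the form used by
    \<open>det_swap_initial_rows\<close>; its last branch lies outside the range of
    \<open>i\<close>.\<close>
  define V where "V = mat (2 * n) (2 * n) (\<lambda>(i, j). (?W * D) $$
    (if i < 2 then i + (2 * n - 2) else if i < 2 * n - 2 + 2 then i - 2 else i, j))"
  have R: "R \<in> carrier_mat 2 (2 * n)"
    using I by (auto simp: R_def last_row_def)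
  have C: "C \<in> carrier_mat (2 * n) (2 * n)" and D: "D \<in> carrier_mat (2 * n) (2 * n)"
    by (simp_all add: C_def D_def)
  have "R * ?W = last_row x"
    unfolding R_def using I mat_inv_mult[OF wronski_carrier inv]
    by (simp add: assoc_mult_mat[of _ 2 "2 * n" _ "2 * n" _ "2 * n"] right_mult_one_mat[OF last_row_carrier])
  have WD: "(?W * D) $$ (i, j) = ?W $$ (i, j) * spec j" if "i < 2 * n" "j < 2 * n" for i j
    using that by (simp add: scalar_prod_def D_def if_distrib[of "\<lambda>z. _ * z"] cong: if_cong)
  txt \<open>$V$ is $W D$ with its last block row moved to the top; with its rows moved in the same way,
    the companion matrix, here $C$, is block upper triangular.\<close>
  have "C * ?W = V"
  proof (rule eq_matI)
    fix i j assume "i < dim_row V" "j < dim_col V"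
    then have ij: "i < 2 * n" "j < 2 * n"
      by (simp_all add: V_def)
    have CW: "(C * ?W) $$ (i, j) = (\<Sum>k<2 * n. C $$ (i, k) * ?W $$ (k, j))"
      using ij C wronski_carrier[of x] by (simp add: scalar_prod_def atLeast0LessThan)
    show "(C * ?W) $$ (i, j) = V $$ (i, j)"
    proof (cases "i < 2")
      case True
      have "(C * ?W) $$ (i, j) = (R * ?W) $$ (i, j)"
        unfolding CW using True ij R wronski_carrier[of x]
        by (simp add: C_def scalar_prod_def atLeast0LessThan)
      also have "\<dots> = seed x i j * spec j ^ n"
        unfolding \<open>R * ?W = last_row x\<close> using True ij by (simp add: last_row_def)
      also have "\<dots> = V $$ (i, j)"
      proof -
        obtain m where m: "n = Suc m"
          using n_pos by (cases n) auto
        then have "i + (2 * n - 2) < 2 * n" "(i + (2 * n - 2)) div 2 = m"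
          "(i + (2 * n - 2)) mod 2 = i mod 2" "spec j ^ n = spec j ^ m * spec j"
          using True by auto
        then show ?thesis
          using True ij by (simp add: V_def WD wronski_index)
      qed
      finally show ?thesis .
    next
      case False
      have "(C * ?W) $$ (i, j) = (\<Sum>k<2 * n. if k = i then ?W $$ (k, j) else 0)"
        unfolding CW using False ij by (intro sum.cong) (auto simp: C_def)
      also have "\<dots> = ?W $$ (i, j)"
        using ij by simp
      also have "\<dots> = V $$ (i, j)"
      proof -
        have "i div 2 = Suc ((i - 2) div 2)" "(i - 2) mod 2 = i mod 2"
          using False by presburger+
        moreover have "i < 2 * n - 2 + 2"
          using ij n_pos by simp
        ultimately show ?thesis
          using False ij by (simp add: V_def WD wronski_index)
      qed
      finally show ?thesis .
    qed
  qed (use C wronski_carrier[of x] in \<open>auto simp: V_def\<close>)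
  \<comment> \<open>Moving two rows past \<open>2 * n - 2\<close> others is an even permutation, so
    no sign appears.\<close>
  moreover have "Determinant.det V = Determinant.det (?W * D)"
    unfolding V_def using n_pos D
    by (subst det_swap_initial_rows[of "?W * D" "2 * n" "2 * n - 2" 2])
       (auto intro: mult_carrier_mat[OF wronski_carrier] simp: power_mult)
  ultimately have "Determinant.det C * Determinant.det ?W = Determinant.det ?W * Determinant.det D"
    using det_mult[OF C wronski_carrier] det_mult[OF wronski_carrier D] by metis
  then have "Determinant.det C = Determinant.det D"
    using inv invertible_mat_iff_det[OF wronski_carrier[of x]] by simp
  moreover have "Determinant.det C = Determinant.det (quasi_wronskian n \<psi> \<Lambda> x)"
  proof -
    define J where "J = quasi_wronskian n \<psi> \<Lambda> x"
    have J: "J \<in> carrier_mat 2 2"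
      using quasi_wronskian_carrier[OF inv] by (simp add: J_def)
    \<comment> \<open>\<open>first_col\<close> selects the first two columns of
      \<open>R\<close>.\<close>
    have "J $$ (i, j) = - R $$ (i, j)" if "i < 2" "j < 2" for i j
    proof -
      have "J $$ (i, j) = - (\<Sum>k<2 * n. R $$ (i, k) * (if k = j then 1 else 0))"
        unfolding J_def quasi_wronskian_eq_mult[OF inv] R_def[symmetric]
        using that R by (simp add: first_col_def scalar_prod_def atLeast0LessThan)
      then show ?thesis
        using that n_pos by (simp add: if_distrib[of "\<lambda>z. _ * z"] cong: if_cong)
    qed
    moreover have "Suc (Suc (j - 2)) = j" if "\<not> j < 2" for j :: nat
      using that by simp
    ultimately have "C = four_block_mat (- 1 \<cdot>\<^sub>m J) (mat 2 (2 * n - 2) (\<lambda>(i, j). R $$ (i, j + 2)))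
        (0\<^sub>m (2 * n - 2) 2) (1\<^sub>m (2 * n - 2))"
      unfolding C_def four_block_mat_def Let_def using n_pos J
      by (intro eq_matI) (auto simp: less_diff_conv2 Suc_1)
    then have "Determinant.det C = Determinant.det (- 1 \<cdot>\<^sub>m J) * 1"
      using det_four_block_mat_lower_left_zero[of "- 1 \<cdot>\<^sub>m J" 2
        "mat 2 (2 * n - 2) (\<lambda>(i, j). R $$ (i, j + 2))" "2 * n - 2"] J by simp
    \<comment> \<open>The sign of \<open>- 1 \<cdot>\<^sub>m J\<close> drops out because the size 2
      is even.\<close>
    then show ?thesis
      using J by (simp add: J_def)
  qed
  moreover have "Determinant.det D = (\<Prod>j<2 * n. spec j)"
    by (subst det_upper_triangular[OF _ D])
       (auto simp: D_def upper_triangular_def prod_list_diag_prod atLeast0LessThan)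
  ultimately show ?thesis
    by simp
qed

lemma quasi_wronskian_quat:
  assumes inv: "invertible_mat (wronski_mat n \<psi> \<Lambda> x)"
  obtains u v where "quasi_wronskian n \<psi> \<Lambda> x = quat u v"
    and "of_real ((cmod u)\<^sup>2 + (cmod v)\<^sup>2) = (\<Prod>j<2 * n. spec j)"
  using quat_conj_fixed_iff_quat[OF quasi_wronskian_carrier quat_conj_quasi_wronskian, OF inv inv]
    det_quasi_wronskian[OF inv] quat_det by metis

end

subsection \<open>Differentiability\<close>

text \<open>Needed because the formulas for the inverse of W and for J are available only near the
  point, where W stays invertible.\<close>

lemma differentiable_eventually_cong:
  assumes "f differentiable at x" and "\<forall>\<^sub>F y in nhds x. f y = g y"
  shows "g differentiable at x"
  using assms differentiable_transform_within[of f x UNIV _ g]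
  unfolding eventually_nhds_metric by auto

lemma differentiable_prod:
  fixes f :: "'i \<Rightarrow> 'a :: real_normed_vector \<Rightarrow> 'b :: {comm_monoid_mult, real_normed_algebra_1}"
  assumes "\<And>i. i \<in> I \<Longrightarrow> f i differentiable at x"
  shows "(\<lambda>y. \<Prod>i\<in>I. f i y) differentiable at x"
  using assms by (induction I rule: infinite_finite_induct) (auto intro: differentiable_mult)

text \<open>By the Leibniz formula the determinant is a polynomial in the entries.\<close>

lemma differentiable_det:
  fixes F :: "'a :: real_normed_vector \<Rightarrow> 'b :: real_normed_field mat"
  assumes "\<And>y. F y \<in> carrier_mat k k"
    and "\<And>i j. i < k \<Longrightarrow> j < k \<Longrightarrow> (\<lambda>y. F y $$ (i, j)) differentiable at x"
  shows "(\<lambda>y. Determinant.det (F y)) differentiable at x"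
proof -
  have "\<pi> i < k" if "\<pi> permutes {0..<k}" "i < k" for \<pi> i
    using permutes_in_image[OF that(1), of i] that(2) by simp
  then have "(\<lambda>y. \<Sum>\<pi> | \<pi> permutes {0..<k}. signof \<pi> * (\<Prod>i = 0..<k. F y $$ (i, \<pi> i))) differentiable at x"
    using assms(2)
    by (auto simp: finite_permutations intro!: differentiable_sum differentiable_mult differentiable_prod)
  then show ?thesis
    by (simp only: det_def'[OF assms(1)])
qed

text \<open>Cramer's rule writes each entry near \<open>x\<close> as a cofactor divided by the
  determinant, and both are differentiable at \<open>x\<close>.\<close>

lemma differentiable_mat_inv:
  fixes F :: "'a :: real_normed_vector \<Rightarrow> complex mat"
  assumes F: "\<And>y. F y \<in> carrier_mat k k"
    and F': "\<And>i j. i < k \<Longrightarrow> j < k \<Longrightarrow> (\<lambda>y. F y $$ (i, j)) differentiable at x"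
    and ev: "\<forall>\<^sub>F y in nhds x. Determinant.det (F y) \<noteq> 0" and ij: "i < k" "j < k"
  shows "(\<lambda>y. mat_inv (F y) $$ (i, j)) differentiable at x"
proof (rule differentiable_eventually_cong)
  have "(\<lambda>y. Determinant.det (mat_delete (F y) j i)) differentiable at x"
  proof (rule differentiable_det)
    show "mat_delete (F y) j i \<in> carrier_mat (k - 1) (k - 1)" for y
      by (rule mat_delete_carrier[OF F])
    show "(\<lambda>y. mat_delete (F y) j i $$ (a, b)) differentiable at x" if "a < k - 1" "b < k - 1" for a b
      using that F'[of "if a < j then a else Suc a" "if b < i then b else Suc b"] F
      by (auto simp: mat_delete_def carrier_matD[OF F])
  qed
  then show "(\<lambda>y. inverse (Determinant.det (F y)) * ((- 1) ^ (j + i) * Determinant.det (mat_delete (F y) j i)))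
      differentiable at x"
    using differentiable_det[OF F F'] eventually_nhds_x_imp_x[OF ev]
    by (intro differentiable_mult differentiable_inverse differentiable_const) auto
  show "\<forall>\<^sub>F y in nhds x. inverse (Determinant.det (F y)) *
      ((- 1) ^ (j + i) * Determinant.det (mat_delete (F y) j i)) = mat_inv (F y) $$ (i, j)"
    using ev
  proof eventually_elim
    case (elim y)
    then show ?case
      using ij carrier_matD[OF F[of y]] mat_inv_eq_adj_mat[OF F elim]
      by (simp add: adj_mat_def cofactor_def)
  qed
qed

lemma differentiable_cnj: "f differentiable F \<Longrightarrow> (\<lambda>y. cnj (f y)) differentiable F"
  unfolding differentiable_def by (blast intro: has_derivative_cnj)

section \<open>Logarithmic derivatives of quaternions of constant norm\<close>

lemma mat_inv_quat:
  assumes "(cmod u)\<^sup>2 + (cmod v)\<^sup>2 = c" "c \<noteq> 0"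
  shows "mat_inv (quat u v) = of_real (1 / c) \<cdot>\<^sub>m quat (cnj u) (- v)" "invertible_mat (quat u v)"
proof -
  have "u * cnj u + v * cnj v = of_real c"
    by (simp flip: complex_norm_square assms(1))
  then have *: "quat u v * (of_real (1 / c) \<cdot>\<^sub>m quat (cnj u) (- v)) = 1\<^sub>m 2"
    "of_real (1 / c) \<cdot>\<^sub>m quat (cnj u) (- v) * quat u v = 1\<^sub>m 2"
    using assms(2) unfolding quat_smult quat_mult quat_one
    by (auto intro!: arg_cong2[of _ _ _ _ quat] simp: field_simps)
  then show "mat_inv (quat u v) = of_real (1 / c) \<cdot>\<^sub>m quat (cnj u) (- v)"
    by (intro mat_inv_eqI[of _ 2]) auto
  show "invertible_mat (quat u v)"
    using * by (intro invertible_matI[of _ 2 "of_real (1 / c) \<cdot>\<^sub>m quat (cnj u) (- v)"]) auto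
qed

text \<open>Along a coordinate line J is a curve \<open>quat (u t) (v t)\<close> of constant squared
  norm \<open>c\<close>. Differentiating the norm gives Re(u' cnj u + v' cnj v) = 0, and the left
  side is c times the real part of the quaternion J' J^(-1).\<close>

lemma partial_mult_mat_inv_in_su2:
  fixes J :: "real^4 \<Rightarrow> complex mat"
  assumes diff: "mat_differentiable J x"
    and ev: "\<forall>\<^sub>F y in nhds x. \<exists>u v. J y = quat u v \<and> (cmod u)\<^sup>2 + (cmod v)\<^sup>2 = c"
    and "c \<noteq> 0"
  shows "partial \<mu> J x * mat_inv (J x) \<in> su2"
proof -
  define l where "l t = x + t *\<^sub>R axis \<mu> 1" for t :: real
  define u where "u t = J (l t) $$ (0, 0)" for t
  define v where "v t = J (l t) $$ (1, 0)" for t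
  have "l differentiable at t" for t
    unfolding l_def by (auto intro!: derivative_intros)
  moreover have "l 0 = x"
    by (simp add: l_def)
  ultimately have "u differentiable at 0" "v differentiable at 0"
    using diff differentiable_chain_at[of l 0 "\<lambda>y. J y $$ (0, 0)"]
      differentiable_chain_at[of l 0 "\<lambda>y. J y $$ (1, 0)"]
    unfolding mat_differentiable_def u_def v_def o_def by auto
  then obtain u' v' where u': "(u has_vector_derivative u') (at 0)" and v': "(v has_vector_derivative v') (at 0)"
    using vector_derivative_works by blast
  have "isCont l 0"
    unfolding l_def by (intro continuous_intros)
  then have "filterlim l (nhds x) (nhds 0)"
    using \<open>l 0 = x\<close> tendsto_at_iff_tendsto_nhds[of l 0] by (simp add: isCont_def)
  from eventually_compose_filterlim[OF ev this]
  have Jl: "\<forall>\<^sub>F t in nhds 0. J (l t) = quat (u t) (v t) \<and> (cmod (u t))\<^sup>2 + (cmod (v t))\<^sup>2 = c"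
    by eventually_elim (auto simp: u_def v_def)
  from eventually_nhds_x_imp_x[OF this] have J0: "J x = quat (u 0) (v 0)" "(cmod (u 0))\<^sup>2 + (cmod (v 0))\<^sup>2 = c"
    using \<open>l 0 = x\<close> by auto
  \<comment> \<open>\<open>partial\<close> differentiates the entries of J itself; a derivative at 0
    depends only on the values near 0, where the quaternionic form holds.\<close>
  have entry: "vector_derivative (\<lambda>t. J (l t) $$ ij) (at 0) = d"
    if "((\<lambda>t. quat (u t) (v t) $$ ij) has_vector_derivative d) (at 0)" for ij d
    using that Jl eventually_nhds_x_imp_x[OF Jl]
    by (intro vector_derivative_at, subst has_vector_derivative_cong_ev[where g = "\<lambda>t. quat (u t) (v t) $$ ij"])
       (auto elim: eventually_mono)
  have "partial \<mu> J x = quat u' v'"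
    unfolding quat_def using u' v'
    by (subst mat2_eq_iff)
       (auto simp: partial_def l_def[symmetric] intro!: entry has_vector_derivative_minus has_vector_derivative_cnj)
  have "Re (u' * cnj (u 0) + v' * cnj (v 0)) = 0"
  proof -
    have "((\<lambda>t. u t * cnj (u t) + v t * cnj (v t)) has_vector_derivative
        (u 0 * cnj u' + u' * cnj (u 0)) + (v 0 * cnj v' + v' * cnj (v 0))) (at 0)"
      by (intro has_vector_derivative_add has_vector_derivative_mult has_vector_derivative_cnj u' v')
    moreover have uv: "\<forall>\<^sub>F t in nhds 0. u t * cnj (u t) + v t * cnj (v t) = of_real c"
      using Jl by eventually_elim (auto simp flip: complex_norm_square)
    have "((\<lambda>t. u t * cnj (u t) + v t * cnj (v t)) has_vector_derivative 0) (at 0) \<longleftrightarrow>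
        ((\<lambda>t. of_real c) has_vector_derivative (0::complex)) (at 0)"
      using uv eventually_nhds_x_imp_x[OF uv] by (intro has_vector_derivative_cong_ev) auto
    ultimately have "(u 0 * cnj u' + u' * cnj (u 0)) + (v 0 * cnj v' + v' * cnj (v 0)) = 0"
      using vector_derivative_unique_at has_vector_derivative_const by blast
    then have "Re ((u 0 * cnj u' + u' * cnj (u 0)) + (v 0 * cnj v' + v' * cnj (v 0))) = 0"
      by simp
    then show ?thesis
      by (simp add: algebra_simps)
  qed
  \<comment> \<open>The upper left entry of the product differs from the expression just treated by
    the factor 1/c and a conjugate on one summand; neither affects the vanishing of the real
    part.\<close>
  moreover have "u' * (of_real (1 / c) * cnj (u 0)) - cnj v' * (of_real (1 / c) * - v 0) =
      of_real (1 / c) * (u' * cnj (u 0) + cnj (v' * cnj (v 0)))"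
    by (simp add: algebra_simps)
  ultimately have "Re (u' * (of_real (1 / c) * cnj (u 0)) - cnj v' * (of_real (1 / c) * - v 0)) = 0"
    by simp
  then show ?thesis
    unfolding J0(1) mat_inv_quat(1)[OF J0(2) \<open>c \<noteq> 0\<close>] \<open>partial \<mu> J x = quat u' v'\<close> quat_smult quat_mult su2_def
    by blast
qed

subsection \<open>Gauge fields of the quasi-Wronskian\<close>

context quaternionic_seed
begin

lemma seed_differentiable:
  assumes "\<And>s. s \<in> {1..n} \<Longrightarrow> p s differentiable at x" "\<And>s. s \<in> {1..n} \<Longrightarrow> q s differentiable at x" "j < 2 * n"
  shows "(\<lambda>y. seed y i j) differentiable at x"
proof -
  have "j div 2 + 1 \<in> {1..n}" "i mod 2 = 0 \<or> i mod 2 = 1" "j mod 2 = 0 \<or> j mod 2 = 1"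
    using assms(3) by auto
  then show ?thesis
    using assms(1,2)[of "j div 2 + 1"]
    by (auto simp: quat_def intro!: differentiable_cnj differentiable_minus)
qed

context
  fixes x
  assumes p': "\<And>s. s \<in> {1..n} \<Longrightarrow> p s differentiable at x"
    and q': "\<And>s. s \<in> {1..n} \<Longrightarrow> q s differentiable at x"
    and inv: "invertible_mat (wronski_mat n \<psi> \<Lambda> x)"
begin

lemma wronski_differentiable:
  "i < 2 * n \<Longrightarrow> j < 2 * n \<Longrightarrow> (\<lambda>y. wronski_mat n \<psi> \<Lambda> y $$ (i, j)) differentiable at x"
  using seed_differentiable[OF p' q'] by (auto simp: wronski_index intro!: differentiable_mult)

text \<open>The determinant of W is continuous at \<open>x\<close> and nonzero there.\<close>

lemma eventually_invertible: "\<forall>\<^sub>F y in nhds x. invertible_mat (wronski_mat n \<psi> \<Lambda> y)"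
proof -
  have "isCont (\<lambda>y. Determinant.det (wronski_mat n \<psi> \<Lambda> y)) x"
    by (intro differentiable_imp_continuous_within differentiable_det[OF wronski_carrier] wronski_differentiable)
  then have "((\<lambda>y. Determinant.det (wronski_mat n \<psi> \<Lambda> y)) \<longlongrightarrow> Determinant.det (wronski_mat n \<psi> \<Lambda> x)) (nhds x)"
    using tendsto_at_iff_tendsto_nhds[of "\<lambda>y. Determinant.det (wronski_mat n \<psi> \<Lambda> y)" x]
    by (simp add: isCont_def)
  then have "\<forall>\<^sub>F y in nhds x. Determinant.det (wronski_mat n \<psi> \<Lambda> y) \<noteq> 0"
    using inv invertible_mat_iff_det[OF wronski_carrier[of x]] by (intro tendsto_imp_eventually_ne) auto
  then show ?thesis
    by eventually_elim (simp add: invertible_mat_iff_det[OF wronski_carrier])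
qed

lemma quasi_wronskian_differentiable: "mat_differentiable (quasi_wronskian n \<psi> \<Lambda>) x"
  unfolding mat_differentiable_def
proof (intro allI impI)
  fix i j :: nat assume ij: "i < 2" "j < 2"
  have "j < 2 * n"
    using ij n_pos by simp
  have inv': "(\<lambda>y. mat_inv (wronski_mat n \<psi> \<Lambda> y) $$ (k, j)) differentiable at x" if "k < 2 * n" for k
    using eventually_invertible that \<open>j < 2 * n\<close>
    by (intro differentiable_mat_inv[OF wronski_carrier wronski_differentiable])
       (auto simp: invertible_mat_iff_det[OF wronski_carrier] elim: eventually_mono)
  show "(\<lambda>y. quasi_wronskian n \<psi> \<Lambda> y $$ (i, j)) differentiable at x"
  proof (rule differentiable_eventually_cong)
    \<comment> \<open>This sum is the entry of J near \<open>x\<close>: \<open>first_col\<close>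
      picks column \<open>j\<close> of the product of the last row with the inverse of W.\<close>
    show "(\<lambda>y. - (\<Sum>k<2 * n. seed y i k * spec k ^ n * mat_inv (wronski_mat n \<psi> \<Lambda> y) $$ (k, j))) differentiable at x"
      using seed_differentiable[OF p' q'] inv'
      by (intro differentiable_minus differentiable_sum differentiable_mult differentiable_const) auto
    show "\<forall>\<^sub>F y in nhds x. - (\<Sum>k<2 * n. seed y i k * spec k ^ n * mat_inv (wronski_mat n \<psi> \<Lambda> y) $$ (k, j)) =
        quasi_wronskian n \<psi> \<Lambda> y $$ (i, j)"
      using eventually_invertible
    proof eventually_elim
      case (elim y)
      note I = mat_inv_carrier[OF wronski_carrier elim]
      let ?R = "last_row y * mat_inv (wronski_mat n \<psi> \<Lambda> y)"
      have "(?R * first_col) $$ (i, j) = (\<Sum>k<2 * n. ?R $$ (i, k) * (if k = j then 1 else 0))"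
        using ij I carrier_matD[OF last_row_carrier] by (simp add: first_col_def scalar_prod_def atLeast0LessThan)
      also have "\<dots> = ?R $$ (i, j)"
        using ij n_pos by (simp add: if_distrib[of "\<lambda>z. _ * z"] cong: if_cong)
      also have "\<dots> = (\<Sum>k<2 * n. seed y i k * spec k ^ n * mat_inv (wronski_mat n \<psi> \<Lambda> y) $$ (k, j))"
        using ij I n_pos by (simp add: last_row_def scalar_prod_def atLeast0LessThan)
      finally show ?case
        unfolding quasi_wronskian_eq_mult[OF elim] using ij by (simp add: first_col_def last_row_def)
    qed
  qed
qed

lemma
  shows invertible_quasi_wronskian: "invertible_mat (quasi_wronskian n \<psi> \<Lambda> x)"
    and partial_quasi_wronskian_in_su2:
      "partial \<mu> (quasi_wronskian n \<psi> \<Lambda>) x * mat_inv (quasi_wronskian n \<psi> \<Lambda> x) \<in> su2"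
proof -
  \<comment> \<open>The product is real, since it equals a squared norm at \<open>x\<close>; so
    \<open>Re\<close> loses nothing. It is independent of the point, and nonzero because every
    \<open>spec j\<close> is.\<close>
  define c where "c = Re (\<Prod>j<2 * n. spec j)"
  have quat: "\<exists>u v. quasi_wronskian n \<psi> \<Lambda> y = quat u v \<and>
      (cmod u)\<^sup>2 + (cmod v)\<^sup>2 = c \<and> of_real c = (\<Prod>j<2 * n. spec j)"
    if inv_y: "invertible_mat (wronski_mat n \<psi> \<Lambda> y)" for y
  proof -
    obtain u v where J: "quasi_wronskian n \<psi> \<Lambda> y = quat u v"
      and uv: "of_real ((cmod u)\<^sup>2 + (cmod v)\<^sup>2) = (\<Prod>j<2 * n. spec j)"
      by (rule quasi_wronskian_quat[OF inv_y])
    from arg_cong[OF uv, of Re] have "(cmod u)\<^sup>2 + (cmod v)\<^sup>2 = c"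
      unfolding c_def Re_complex_of_real .
    with J uv show ?thesis
      by blast
  qed
  from quat[OF inv] obtain u v where J: "quasi_wronskian n \<psi> \<Lambda> x = quat u v"
      "(cmod u)\<^sup>2 + (cmod v)\<^sup>2 = c" and c: "of_real c = (\<Prod>j<2 * n. spec j)"
    by blast
  from c have "c \<noteq> 0"
    using spec_nonzero by auto
  show "partial \<mu> (quasi_wronskian n \<psi> \<Lambda>) x * mat_inv (quasi_wronskian n \<psi> \<Lambda> x) \<in> su2"
  proof (rule partial_mult_mat_inv_in_su2[OF quasi_wronskian_differentiable _ \<open>c \<noteq> 0\<close>])
    show "\<forall>\<^sub>F y in nhds x. \<exists>u v. quasi_wronskian n \<psi> \<Lambda> y = quat u v \<and> (cmod u)\<^sup>2 + (cmod v)\<^sup>2 = c"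
      using eventually_invertible by (rule eventually_mono) (use quat in blast)
  qed
  show "invertible_mat (quasi_wronskian n \<psi> \<Lambda> x)"
    unfolding J(1) by (rule mat_inv_quat(2)[OF J(2) \<open>c \<noteq> 0\<close>])
qed

text \<open>su(2) is a real vector space, and each gauge field is a real combination of logarithmic
  derivatives of J.\<close>

lemma gauge_field_in_su2: "gauge_field (quasi_wronskian n \<psi> \<Lambda>) \<mu> x \<in> su2"
  using su2_smult[OF su2_add[OF partial_quasi_wronskian_in_su2 partial_quasi_wronskian_in_su2], of "- 1 / 2"]
  by (simp add: gauge_field_def)

end

end

section \<open>Application to the exponential seeds\<close>

theorem theorem6p3:
  fixes n :: nat
    and a1 a2 b1 b2 \<alpha> \<beta> lam :: "nat \<Rightarrow> complex"
    and L A B :: "nat \<Rightarrow> real^4 \<Rightarrow> complex"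
    and \<psi> :: "nat \<Rightarrow> real^4 \<Rightarrow> complex mat"
    and \<Lambda> :: "nat \<Rightarrow> complex mat"
    and J :: "real^4 \<Rightarrow> complex mat"
    and x :: "real^4"
  assumes "n \<ge> 1"
    and "\<And>i. i \<in> {1..n} \<Longrightarrow> lam i \<noteq> 0"
    and "\<And>i y. i \<in> {1..n} \<Longrightarrow> L i y = 1 / complex_of_real (sqrt 2) *
          ((lam i * \<alpha> i + \<beta> i) * complex_of_real (y $ 1)
         + (lam i * \<beta> i - \<alpha> i) * complex_of_real (y $ 2)
         + (lam i * \<alpha> i - \<beta> i) * complex_of_real (y $ 3)
         + (lam i * \<beta> i + \<alpha> i) * complex_of_real (y $ 4))"
    and "\<And>i y. i \<in> {1..n} \<Longrightarrow> A i y = a1 i * exp (L i y) + a2 i * exp (- L i y)"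
    and "\<And>i y. i \<in> {1..n} \<Longrightarrow> B i y = b1 i * exp (L i y) + b2 i * exp (- L i y)"
    and "\<And>i y. i \<in> {1..n} \<Longrightarrow> \<psi> i y = mat2 (A i y) (cnj (B i y)) (- B i y) (cnj (A i y))"
    and "\<And>i. i \<in> {1..n} \<Longrightarrow> \<Lambda> i = mat2 (lam i) 0 0 (cnj (lam i))"
    and "\<And>y. J y = quasi_wronskian n \<psi> \<Lambda> y"
    and "invertible_mat (wronski_mat n \<psi> \<Lambda> x)"
  shows "mat_differentiable J x \<and> invertible_mat (J x) \<and>
    (\<forall>\<mu>. mat_adjoint (gauge_field J \<mu> x) = - gauge_field J \<mu> x \<and>
         mat_trace (gauge_field J \<mu> x) = 0 \<and>
         gauge_field J \<mu> x \<in> lie_algebra 2 SU2)"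
proof -
  \<comment> \<open>The second parameter is \<open>- B i\<close> because \<open>quat\<close> takes
    the lower left entry.\<close>
  interpret quaternionic_seed n A "\<lambda>i y. - B i y" lam \<psi> \<Lambda>
    using assms(1,2,6,7) by unfold_locales (simp_all add: quat_def)
  \<comment> \<open>Differentiability is built up from the coordinates: \<open>L i\<close> is linear
    in them with complex coefficients, and \<open>A i\<close> and \<open>B i\<close> arise from it
    by exponentials.\<close>
  have coord: "(\<lambda>y::real^4. complex_of_real (y $ k)) differentiable at x" for k
    by (intro bounded_linear_imp_differentiable
        bounded_linear_compose[OF bounded_linear_of_real bounded_linear_vec_nth])
  have L': "L i differentiable at x" if "i \<in> {1..n}" for i
    unfolding assms(3)[OF that, abs_def]
    by (intro differentiable_add differentiable_mult differentiable_const coord)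
  have exp': "(\<lambda>y. exp (f y)) differentiable at x" if "f differentiable at x" for f :: "real^4 \<Rightarrow> complex"
    using differentiable_chain_at[OF that, of exp]
      DERIV_exp[of "f x", THEN has_field_derivative_imp_has_derivative, THEN differentiableI]
    by (simp add: o_def)
  have A': "A i differentiable at x" if "i \<in> {1..n}" for i
    unfolding assms(4)[OF that, abs_def] using L'[OF that]
    by (intro differentiable_add differentiable_mult differentiable_const exp' differentiable_minus)
  have B': "(\<lambda>y. - B i y) differentiable at x" if "i \<in> {1..n}" for i
    unfolding assms(5)[OF that] using L'[OF that]
    by (intro differentiable_add differentiable_mult differentiable_const exp' differentiable_minus)
  have J: "J = quasi_wronskian n \<psi> \<Lambda>"
    using assms(8) by blast
  show ?thesis
    using quasi_wronskian_differentiable[OF A' B' assms(9)] invertible_quasi_wronskian[OF A' B' assms(9)]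
      gauge_field_in_su2[OF A' B' assms(9)] su2_adjoint su2_trace su2_subset_lie_algebra
    unfolding J by blast
qed

end
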